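(* Let $G=(V,E)$ be a simple connected graph with $n=|V|$, and let $\{V_1,V_2,V_3,V_4\}$ be a feasible tetrapartition of $V$ with $|V_1|\le|V_2|\le|V_3|\le|V_4|$ and $|V_4|>\frac25 n$, to which no Merge and no Pull operation is applicable, and such that $|V_2|+|V_3|\ge|V_4|$, $|V_4|<\frac12 n$, $|V_1|\le|V_2|<\frac16|V_4|<\frac1{12}n$, and $|V_3|>\frac13 n$. Suppose we are in Case 2: neither $V_1$ nor $V_2$ is adjacent to $V_4$, and both $V_1$ and $V_2$ are adjacent to $V_3$ only at a single vertex $v\in V_3$ (i.e. every edge between $V_1\cup V_2$ and $V_3\cup V_4$ has $v$ as its endpoint in $V_3\cup V_4$). Let $V'_3$ be the union of the vertex sets of all connected components of $G[V_3\setminus\{v\}]$ that are adjacent to $V_4$. If $|V'_3|\le|V_2|+\frac{11}{24}|V_4|$, then $|V_4|\le\frac{24}{13}\,\mathrm{OPT}$.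
   Context: A feasible tetrapartition of $V$ is a partition into four non-empty parts each inducing a connected subgraph of $G$; $\mathrm{OPT}$ is the minimum, over all feasible tetrapartitions, of the largest part size. Two disjoint vertex sets are adjacent if some edge joins them. For a sorted feasible tetrapartition with $|V_4|>\frac25 n$: a Merge operation is applicable if there are distinct $i,j\in\{1,2,3\}$ with $V_i,V_j$ adjacent and $|V_i|+|V_j|<|V_4|$; a Pull operation is applicable if no Merge is applicable and there exist $(i,j)\in\{(1,3),(1,4),(2,3),(2,4),(3,4)\}$ and a non-empty proper subset $U\subset V_j$ with $G[U]$ and $G[V_j\setminus U]$ connected, $U$ adjacent to $V_i$, and $|V_i|+|U|<|V_j|$. *)

theory Defs
  imports Complex_Main "HOL-Library.Disjoint_Sets" "Graph_Theory.Digraph_Component"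
begin

text \<open>
  Finite simple undirected graphs are represented as in \<^theory>\<open>Graph_Theory.Digraph\<close>
  (locale \<^locale>\<open>graph\<close>): finite, loop-free, symmetric digraphs without parallel arcs, an
  undirected edge being a pair of opposite arcs. The null graph does not satisfy
  \<^const>\<open>Digraph_Component.connected\<close>.
\<close>

definition adjacent :: "('a, 'b) pre_digraph \<Rightarrow> 'a set \<Rightarrow> 'a set \<Rightarrow> bool" where
  "adjacent G A B \<longleftrightarrow> (\<exists>a\<in>A. \<exists>b\<in>B. a \<rightarrow>\<^bsub>G\<^esub> b)"

definition component_verts :: "('a, 'b) pre_digraph \<Rightarrow> 'a set set" where
  "component_verts G = verts ` {H. pre_digraph.max_subgraph G Digraph_Component.connected H}"

definition feasible_tetrapartition :: "('a, 'b) pre_digraph \<Rightarrow> 'a set set \<Rightarrow> bool" where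
  "feasible_tetrapartition G P \<longleftrightarrow>
     partition_on (verts G) P \<and> card P = 4 \<and>
     (\<forall>X\<in>P. Digraph_Component.connected (G \<restriction> X))"

text \<open>The minimum is meaningful only if a feasible tetrapartition exists.\<close>

definition opt :: "('a, 'b) pre_digraph \<Rightarrow> nat" where
  "opt G = Min {Max (card ` P) | P. feasible_tetrapartition G P}"

text \<open>
  In the following two definitions the tetrapartition is the family \<open>V 1, V 2, V 3, V 4\<close>,
  sorted by size; the other values of \<open>V\<close> are irrelevant.
\<close>

definition merge_applicable :: "('a, 'b) pre_digraph \<Rightarrow> (nat \<Rightarrow> 'a set) \<Rightarrow> bool" where
  "merge_applicable G V \<longleftrightarrow>
     (\<exists>i\<in>{1, 2, 3}. \<exists>j\<in>{1, 2, 3}. i \<noteq> j \<and>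
        adjacent G (V i) (V j) \<and> card (V i) + card (V j) < card (V 4))"

definition pull_applicable :: "('a, 'b) pre_digraph \<Rightarrow> (nat \<Rightarrow> 'a set) \<Rightarrow> bool" where
  "pull_applicable G V \<longleftrightarrow>
     \<not> merge_applicable G V \<and>
     (\<exists>(i, j)\<in>{(1, 3), (1, 4), (2, 3), (2, 4), (3, 4)}. \<exists>U.
        U \<noteq> {} \<and> U \<subset> V j \<and>
        Digraph_Component.connected (G \<restriction> U) \<and>
        Digraph_Component.connected (G \<restriction> (V j - U)) \<and>
        adjacent G U (V i) \<and> card (V i) + card U < card (V j))"

end

theory Submission
  imports Defs
begin

text \<open>
  The components of \<open>G - v\<close> are \<open>K = V\<^sub>4 \<union> V\<^sub>3'\<close>, the sets
  \<open>V\<^sub>1\<close>, \<open>V\<^sub>2\<close> and the components of \<open>G[V\<^sub>3 \<setminus> {v}]\<close> not adjacent to \<open>V\<^sub>4\<close>. A component \<open>C\<close> of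
  \<open>G[V\<^sub>3 \<setminus> {v}]\<close> satisfies \<open>|C| \<le> |V\<^sub>1|\<close>, since otherwise \<open>V\<^sub>3 \<setminus> C\<close> could be pulled to \<open>V\<^sub>1\<close>.
  Suppose that all parts of a feasible tetrapartition have size below \<open>13/24 |V\<^sub>4|\<close>. As
  \<open>n > 2 |V\<^sub>4|\<close>, no part can be smaller than \<open>|V\<^sub>4|/6\<close>, so the three parts avoiding \<open>v\<close> lie in
  \<open>K\<close> and the fourth contains the complement of \<open>K\<close>. The size of that complement is
  \<open>|V\<^sub>1| + |V\<^sub>2| + |V\<^sub>3| - |V\<^sub>3'|\<close>, which is at least \<open>13/24 |V\<^sub>4|\<close> because
  \<open>|V\<^sub>1| + |V\<^sub>3| \<ge> |V\<^sub>4|\<close>, the sets \<open>V\<^sub>1\<close> and \<open>V\<^sub>3\<close> being adjacent but not mergeable.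
\<close>

section \<open>Connectedness and components of symmetric digraphs\<close>

lemma strongly_connected_imp_connected:
  assumes "strongly_connected G"
  shows "Digraph_Component.connected G"
proof -
  have "rtrancl_on (verts G) (arcs_ends G) \<subseteq> rtrancl_on (verts G) ((arcs_ends G)\<^sup>s)"
    by (auto simp: symcl_def intro: rtrancl_on_mono)
  with assms show ?thesis
    unfolding strongly_connected_def reachable_def connected_conv by blast
qed

text \<open>Extra arcs on an unchanged vertex set cannot disconnect a graph. Hence maximal connected
  subgraphs are induced.\<close>

lemma arc_mono_connected: "arc_mono Digraph_Component.connected"
  unfolding arc_mono_def
  by (metis spanning_def subgraphE wf_digraph.connected_spanning_imp_connected)

context sym_digraph
begin

lemma sym_digraph_induce: "sym_digraph (G \<restriction> A)"
proof (rule wf_digraph.sym_digraphI)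
  show "symmetric (G \<restriction> A)"
    using sym_arcs by (fastforce simp: symmetric_conv)
qed (rule wellformed_induce_subgraph)

lemma strongly_connected_induce_iff:
  "strongly_connected (G \<restriction> A) \<longleftrightarrow> Digraph_Component.connected (G \<restriction> A)"
  using sym_digraph.sym_arcs[OF sym_digraph_induce]
    wf_digraph.symmetric_connected_imp_strongly_connected[OF wellformed_induce_subgraph]
    strongly_connected_imp_connected by blast

text \<open>Makes the theory of strongly connected components available for
  \<open>component_verts\<close>. The two maximality notions agree because induced subgraphs of a
  symmetric digraph are symmetric, so for them connected and strongly connected coincide.\<close>

lemma component_verts_eq_sccs_verts: "component_verts G = sccs_verts"
proof -
  have "max_subgraph Digraph_Component.connected H \<longleftrightarrow> max_subgraph strongly_connected H" for H
  proof
    assume max: "max_subgraph Digraph_Component.connected H"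
    then have "G \<restriction> verts H = H"
      by (intro induce_eq_iff_induced induced_subgraphI_arc_mono[OF _ arc_mono_connected])
    with max_subgraph_prop[OF max] have "strongly_connected H"
      by (metis strongly_connected_induce_iff)
    then show "max_subgraph strongly_connected H"
      using max_subgraph_mp[OF max, of strongly_connected] strongly_connected_imp_connected
      by blast
  next
    assume max: "max_subgraph strongly_connected H"
    show "max_subgraph Digraph_Component.connected H"
    proof (rule max_subgraphI)
      show "Digraph_Component.connected H"
        using max_subgraph_prop[OF max] by (rule strongly_connected_imp_connected)
      show "subgraph H G" using max by (rule subgraphI_max_subgraph)
    next
      fix H' assume H': "H \<noteq> H'" "subgraph H H'" "subgraph H' G"
      show "\<not> Digraph_Component.connected H'"
      proof
        assume "Digraph_Component.connected H'"
        \<comment> \<open>\<open>H'\<close> need not be symmetric, so its connectedness alone does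
          not give strong connectedness; the induced graph on the same vertices has both.\<close>
        let ?I = "G \<restriction> verts H'"
        have H'I: "subgraph H' ?I" and IG: "subgraph ?I G"
          using H'(3) by (auto intro: subgraph_induce_subgraphI2 subgraph_induce_subgraphI)
        have "Digraph_Component.connected ?I"
          using arc_mono_connected H'I \<open>Digraph_Component.connected H'\<close>
          unfolding arc_mono_def by (metis induce_subgraph_verts)
        then have "strongly_connected ?I" by (simp add: strongly_connected_induce_iff)
        with max IG subgraph_trans[OF H'(2) H'I] have "?I = H"
          unfolding max_subgraph_def by metis
        with H'I have "subgraph H' H" by simp
        with H'(2) have "H = H'"
          by (intro pre_digraph.equality) (auto dest: compatible_tail compatible_head)
        with H'(1) show False ..
      qed
    qed
  qed
  then show ?thesis
    by (simp add: component_verts_def sccs_verts_conv sccs_altdef2)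
qed

lemma adjacent_sym: "adjacent G A B \<Longrightarrow> adjacent G B A"
  unfolding adjacent_def using graph_symmetric by blast

text \<open>A path inside \<open>A\<close> that starts in \<open>B\<close> never leaves
  \<open>B\<close>.\<close>

lemma connected_induce_subsetI:
  assumes "Digraph_Component.connected (G \<restriction> A)" and "A \<inter> B \<noteq> {}"
    and closed: "\<not> adjacent G (A \<inter> B) (A - B)"
  shows "A \<subseteq> B"
proof
  fix y assume "y \<in> A"
  from assms(2) obtain x where x: "x \<in> A" "x \<in> B" by blast
  interpret A: wf_digraph "G \<restriction> A" by (rule wellformed_induce_subgraph)
  have "x \<rightarrow>\<^sup>*\<^bsub>G \<restriction> A\<^esub> y"
    using assms(1) x \<open>y \<in> A\<close>
    by (auto simp: strongly_connected_induce_iff[symmetric] strongly_connected_def)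
  then show "y \<in> B"
  proof (induct rule: A.reachable_induct)
    case base
    show ?case using x by simp
  next
    case (step y z)
    then have "y \<in> A" "z \<in> A" using A.adj_in_verts by auto
    with step closed show ?case
      by (auto simp: adjacent_def dest: dominates_induce_subgraphD)
  qed
qed

text \<open>Cut criterion with a root: the vertices of \<open>A\<close> not reachable from
  \<open>r\<close> would form a set \<open>D\<close> without arcs to the rest of
  \<open>A\<close>.\<close>

lemma connected_induceI:
  assumes "r \<in> A"
    and cut: "\<And>D. \<lbrakk>D \<subseteq> A; D \<noteq> {}; r \<notin> D\<rbrakk> \<Longrightarrow> adjacent G D (A - D)"
  shows "Digraph_Component.connected (G \<restriction> A)"
proof -
  interpret A: sym_digraph "G \<restriction> A" by (rule sym_digraph_induce)
  let ?D = "{w \<in> A. \<not> r \<rightarrow>\<^sup>*\<^bsub>G \<restriction> A\<^esub> w}"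
  have "?D = {}"
  proof (rule ccontr)
    assume "?D \<noteq> {}"
    then have "adjacent G ?D (A - ?D)" using assms(1) by (intro cut) auto
    then obtain x y where xy: "x \<in> A" "\<not> r \<rightarrow>\<^sup>*\<^bsub>G \<restriction> A\<^esub> x" "y \<in> A" "r \<rightarrow>\<^sup>*\<^bsub>G \<restriction> A\<^esub> y" "x \<rightarrow> y"
      unfolding adjacent_def by blast
    then have "y \<rightarrow> x" by (blast intro: graph_symmetric)
    with xy have "y \<rightarrow>\<^bsub>G \<restriction> A\<^esub> x" by (auto simp: arcs_ends_conv)
    with xy show False by (blast intro: A.reachable_adj_trans)
  qed
  then have reach: "r \<rightarrow>\<^sup>*\<^bsub>G \<restriction> A\<^esub> w" if "w \<in> A" for w using that by blast
  have "strongly_connected (G \<restriction> A)"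
  proof (rule strongly_connectedI)
    fix u w assume "u \<in> verts (G \<restriction> A)" "w \<in> verts (G \<restriction> A)"
    then show "u \<rightarrow>\<^sup>*\<^bsub>G \<restriction> A\<^esub> w"
      using A.reachable_trans[OF symmetric_reachable[OF A.sym_arcs reach] reach] by simp
  qed (use assms(1) in auto)
  then show ?thesis by (rule strongly_connected_imp_connected)
qed

lemma component_vertsD:
  assumes "C \<in> component_verts G"
  shows "C \<subseteq> verts G" and "C \<noteq> {}" and "Digraph_Component.connected (G \<restriction> C)"
    and "\<not> adjacent G C (- C)"
proof -
  note C = assms[unfolded component_verts_eq_sccs_verts]
  show "C \<subseteq> verts G" using C by (rule sccs_verts_subsets)
  show "C \<noteq> {}" using C by (auto simp: in_sccs_verts_conv_reachable)
  have "strongly_connected (G \<restriction> C)" using C in_verts_sccsD_sccs by (auto simp: sccs_def)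
  then show "Digraph_Component.connected (G \<restriction> C)" by (rule strongly_connected_imp_connected)
  show "\<not> adjacent G C (- C)"
  proof
    assume "adjacent G C (- C)"
    then obtain x y where "x \<in> C" "y \<notin> C" "x \<rightarrow> y" by (auto simp: adjacent_def)
    moreover from this have "y \<rightarrow> x" by (blast intro: graph_symmetric)
    ultimately show False
      using C reachable_adjI unfolding in_sccs_verts_conv_reachable by blast
  qed
qed

lemma component_verts_cover:
  assumes "x \<in> verts G"
  obtains C where "C \<in> component_verts G" and "x \<in> C"
proof -
  obtain c where "c \<in> sccs" "x \<in> verts c" using scc_for_vert_ex[OF assms] by blast
  then show thesis
    using that[of "verts c"] by (simp add: component_verts_eq_sccs_verts sccs_verts_conv)
qed

lemma induce_induce: "B \<subseteq> A \<Longrightarrow> (G \<restriction> A) \<restriction> B = G \<restriction> B"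
  by (auto simp: induce_subgraph_def)

lemma component_verts_induceD:
  assumes "C \<in> component_verts (G \<restriction> A)"
  shows "C \<subseteq> A" and "C \<noteq> {}" and "Digraph_Component.connected (G \<restriction> C)"
    and "\<not> adjacent G C (A - C)"
proof -
  interpret A: sym_digraph "G \<restriction> A" by (rule sym_digraph_induce)
  show "C \<subseteq> A" using A.component_vertsD(1)[OF assms] by simp
  then show "Digraph_Component.connected (G \<restriction> C)"
    using A.component_vertsD(3)[OF assms] by (simp add: induce_induce)
  show "C \<noteq> {}" using A.component_vertsD(2)[OF assms] .
  show "\<not> adjacent G C (A - C)"
    using A.component_vertsD(4)[OF assms] \<open>C \<subseteq> A\<close>
    by (fastforce simp: adjacent_def arcs_ends_conv)
qed

text \<open>The rest of \<open>A\<close> hangs together through \<open>v\<close>: an arc leaving a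
  set \<open>D\<close> that avoids \<open>v\<close> and \<open>C\<close> cannot end in
  \<open>C\<close>, since \<open>C\<close> has no arcs to the other vertices of
  \<open>A - {v}\<close>. This makes the complement of a component a legal choice in a Pull.\<close>

lemma connected_induce_diff_component:
  assumes "Digraph_Component.connected (G \<restriction> A)" and "v \<in> A"
    and C: "C \<in> component_verts (G \<restriction> (A - {v}))"
  shows "Digraph_Component.connected (G \<restriction> (A - C))"
proof (rule connected_induceI)
  note CD = component_verts_induceD[OF C]
  show "v \<in> A - C" using CD(1) assms(2) by blast
  fix D assume D: "D \<subseteq> A - C" "D \<noteq> {}" "v \<notin> D"
  then have "\<not> adjacent G D C"
    using CD(4) adjacent_sym[of D C] by (auto simp: adjacent_def)
  moreover have "adjacent G (A \<inter> D) (A - D)"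
    using connected_induce_subsetI[OF assms(1), of D] assms(2) D by blast
  ultimately show "adjacent G D (A - C - D)"
    using D unfolding adjacent_def by blast
qed

end

section \<open>Feasible tetrapartitions\<close>

text \<open>There are finitely many feasible tetrapartitions, and \<open>Q\<close> shows that there
  is one, so the minimum is attained.\<close>

lemma ex_tetrapartition_le_opt:
  assumes "finite (verts G)" and "feasible_tetrapartition G Q"
  obtains P where "feasible_tetrapartition G P" and "\<And>X. X \<in> P \<Longrightarrow> card X \<le> opt G"
proof -
  let ?F = "{P. feasible_tetrapartition G P}"
  have "?F \<subseteq> Pow (Pow (verts G))"
    by (auto simp: feasible_tetrapartition_def partition_on_def)
  then have "finite ((\<lambda>P. Max (card ` P)) ` ?F)"
    using assms(1) by (meson finite_Pow_iff finite_imageI finite_subset)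
  then have "opt G \<in> (\<lambda>P. Max (card ` P)) ` ?F"
    unfolding opt_def setcompr_eq_image using assms(2) by (intro Min_in) auto
  then obtain P where P: "feasible_tetrapartition G P" "opt G = Max (card ` P)" by blast
  moreover have "finite P"
    using P(1) by (intro card_ge_0_finite) (simp add: feasible_tetrapartition_def)
  ultimately show thesis by (intro that[of P]) auto
qed

theorem theorem5:
  fixes G :: "('a, 'b) pre_digraph" and V :: "nat \<Rightarrow> 'a set" and v :: 'a
    and n :: nat and V3' :: "'a set"
  assumes "graph G" and "Digraph_Component.connected G"
    and "n = card (verts G)"
    and "feasible_tetrapartition G {V 1, V 2, V 3, V 4}"
    and "card (V 1) \<le> card (V 2)" and "card (V 2) \<le> card (V 3)" and "card (V 3) \<le> card (V 4)"
    and "real (card (V 4)) > 2 / 5 * real n"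
    and "\<not> merge_applicable G V" and "\<not> pull_applicable G V"
    and "card (V 2) + card (V 3) \<ge> card (V 4)"
    and "real (card (V 4)) < 1 / 2 * real n"
    and "real (card (V 2)) < 1 / 6 * real (card (V 4))"
    and "1 / 6 * real (card (V 4)) < 1 / 12 * real n"
    and "real (card (V 3)) > 1 / 3 * real n"
    and "\<not> adjacent G (V 1) (V 4)" and "\<not> adjacent G (V 2) (V 4)"
    and "v \<in> V 3"
    and "adjacent G (V 1) (V 3)" and "adjacent G (V 2) (V 3)"
    and "\<forall>x \<in> V 1 \<union> V 2. \<forall>y \<in> V 3 \<union> V 4. x \<rightarrow>\<^bsub>G\<^esub> y \<longrightarrow> y = v"
    and "V3' = \<Union> {C \<in> component_verts (G \<restriction> (V 3 - {v})). adjacent G C (V 4)}"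
    and "real (card V3') \<le> real (card (V 2)) + 11 / 24 * real (card (V 4))"
  shows "real (card (V 4)) \<le> 24 / 13 * real (opt G)"
proof -
  interpret graph G by fact
  note sorted = assms(5-7) and small = assms(13)
    and v = assms(18) and only_v = assms(21) and V3' = assms(22)
  let ?m = "real (card (V 4))"
  have part: "partition_on (verts G) {V 1, V 2, V 3, V 4}"
    and card4: "card {V 1, V 2, V 3, V 4} = 4"
    and conn: "Digraph_Component.connected (G \<restriction> V 3)"
    using assms(4) by (auto simp: feasible_tetrapartition_def)
  have neq: "V 1 \<noteq> V 2" "V 1 \<noteq> V 3" "V 1 \<noteq> V 4" "V 2 \<noteq> V 3" "V 2 \<noteq> V 4" "V 3 \<noteq> V 4"
    using card4 by (auto simp: card_insert_if split: if_splits)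
  have disj: "V 1 \<inter> V 2 = {}" "V 1 \<inter> V 3 = {}" "V 1 \<inter> V 4 = {}"
    "V 2 \<inter> V 3 = {}" "V 2 \<inter> V 4 = {}" "V 3 \<inter> V 4 = {}"
    using partition_onD2[OF part] neq unfolding disjoint_def by blast+
  have verts: "verts G = V 1 \<union> V 2 \<union> V 3 \<union> V 4"
    using partition_onD1[OF part] by auto
  have fin: "finite (V 1)" "finite (V 2)" "finite (V 3)" "finite (V 4)"
    using finite_verts unfolding verts by auto
  have n: "n = card (V 1) + card (V 2) + card (V 3) + card (V 4)"
    unfolding \<open>n = card (verts G)\<close> verts using fin disj
    by (simp add: card_Un_disjoint Int_Un_distrib2)

  \<comment> \<open>Consequences of the absence of Merge and Pull\<close>
  have unmerged: "card (V 4) \<le> card (V i) + card (V j)"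
    if "i \<in> {1, 2, 3}" "j \<in> {1, 2, 3}" "i \<noteq> j" "adjacent G (V i) (V j)" for i j
    using assms(9) that unfolding merge_applicable_def by (meson not_le)
  have V13: "card (V 4) \<le> card (V 1) + card (V 3)"
    using unmerged[of 1 3] assms(19) by simp
  have V12: "\<not> adjacent G (V 1) (V 2)"
    using unmerged[of 1 2] sorted small by auto

  have component_le: "card C \<le> card (V 1)" if C: "C \<in> component_verts (G \<restriction> (V 3 - {v}))" for C
  proof (rule ccontr)
    assume "\<not> card C \<le> card (V 1)"
    note CD = component_verts_induceD[OF C]
    have CV: "v \<in> V 3 - C" "C \<subseteq> V 3" using v CD(1) by auto
    \<comment> \<open>This set keeps \<open>v\<close> and therefore its adjacency to
      \<open>V 1\<close>; the size condition of the Pull then amounts to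
      \<open>card (V 1) < card C\<close>.\<close>
    let ?U = "V 3 - C"
    have VU: "V 3 - ?U = C" using CV(2) by blast
    obtain x y where "x \<in> V 1" "y \<in> V 3" "x \<rightarrow>\<^bsub>G\<^esub> y"
      using assms(19) by (auto simp: adjacent_def)
    then have "v \<rightarrow>\<^bsub>G\<^esub> x" using only_v graph_symmetric by blast
    with \<open>x \<in> V 1\<close> CV(1) have "adjacent G ?U (V 1)"
      unfolding adjacent_def by blast
    moreover have "card (V 1) + card ?U < card (V 3)"
      using \<open>\<not> card C \<le> card (V 1)\<close> card_mono[OF fin(3) CV(2)]
        card_Diff_subset[OF finite_subset[OF CV(2) fin(3)] CV(2)] by linarith
    moreover have "Digraph_Component.connected (G \<restriction> ?U)"
      by (rule connected_induce_diff_component[OF conn v C])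
    moreover have "Digraph_Component.connected (G \<restriction> (V 3 - ?U))"
      unfolding VU by (rule CD(3))
    moreover have "?U \<noteq> {}" "?U \<subset> V 3" using CV CD(2) by auto
    ultimately have "\<exists>U. U \<noteq> {} \<and> U \<subset> V 3 \<and> Digraph_Component.connected (G \<restriction> U) \<and>
        Digraph_Component.connected (G \<restriction> (V 3 - U)) \<and>
        adjacent G U (V 1) \<and> card (V 1) + card U < card (V 3)"
      by (intro exI[of _ ?U] conjI)
    then have "pull_applicable G V"
      unfolding pull_applicable_def using assms(9) by simp
    with assms(10) show False by blast
  qed

  \<comment> \<open>Unions of components of \<open>G\<close> minus \<open>v\<close>\<close>
  define K where "K = V 4 \<union> V3'"
  have V3'_sub: "V3' \<subseteq> V 3 - {v}"
    unfolding V3' using component_verts_induceD(1) by blast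
  have "v \<notin> K" using V3'_sub v disj unfolding K_def by blast

  have cover: "\<exists>C \<in> component_verts (G \<restriction> (V 3 - {v})). x \<in> C" if "x \<in> V 3" "x \<noteq> v" for x
    using sym_digraph.component_verts_cover[OF sym_digraph_induce, of x "V 3 - {v}"] that
    by auto

  \<comment> \<open>For a set of vertices avoiding \<open>v\<close> this means being a union of
    components of \<open>G\<close> minus \<open>v\<close>. A connected part that avoids
    \<open>v\<close> and meets such a set lies inside it.\<close>
  define closed where "closed S \<longleftrightarrow> (\<forall>x\<in>S. \<forall>y\<in>verts G. x \<rightarrow>\<^bsub>G\<^esub> y \<longrightarrow> y \<in> S \<or> y = v)" for S
  have attach: "x = v" if "y \<in> V 1 \<union> V 2" "x \<in> V 3 \<union> V 4" "x \<rightarrow>\<^bsub>G\<^esub> y \<or> y \<rightarrow>\<^bsub>G\<^esub> x" for x y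
    using only_v that graph_symmetric by blast
  have closed_V1: "closed (V 1)"
    using V12 attach unfolding closed_def verts adjacent_def by blast
  have closed_V2: "closed (V 2)"
    using adjacent_sym[of "V 2" "V 1"] V12 attach unfolding closed_def verts adjacent_def by blast
  have closed_C: "closed C"
    if C: "C \<in> component_verts (G \<restriction> (V 3 - {v}))" and nadj: "\<not> adjacent G C (V 4)" for C
  proof -
    note CD = component_verts_induceD[OF C]
    show ?thesis
      unfolding closed_def verts
    proof (intro ballI impI)
      fix x y assume "x \<in> C" "y \<in> V 1 \<union> V 2 \<union> V 3 \<union> V 4" "x \<rightarrow>\<^bsub>G\<^esub> y"
      moreover have "y \<notin> V 4" using nadj calculation unfolding adjacent_def by blast
      moreover have "y \<notin> V 1 \<union> V 2" using attach[of y x] CD(1) calculation by blast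
      ultimately show "y \<in> C \<or> y = v" using CD(4) unfolding adjacent_def by blast
    qed
  qed
  have closed_K: "closed K"
    unfolding closed_def verts
  proof (intro ballI impI)
    fix x y assume x: "x \<in> K" and y: "y \<in> V 1 \<union> V 2 \<union> V 3 \<union> V 4" and "x \<rightarrow>\<^bsub>G\<^esub> y"
    have "y \<notin> V 1 \<union> V 2"
      using attach[of y x] x \<open>x \<rightarrow>\<^bsub>G\<^esub> y\<close> \<open>v \<notin> K\<close> V3'_sub unfolding K_def by blast
    moreover have "y \<in> K" if "y \<in> V 3" "y \<noteq> v"
    proof -
      obtain C where C: "C \<in> component_verts (G \<restriction> (V 3 - {v}))" "y \<in> C"
        using cover \<open>y \<in> V 3\<close> \<open>y \<noteq> v\<close> by blast
      show ?thesis
      \<comment> \<open>From \<open>V 4\<close> the arc itself shows that the component of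
        \<open>y\<close> belongs to \<open>V3'\<close>; from \<open>V3'\<close> it stays in the
        component of \<open>x\<close>.\<close>
      proof (cases "x \<in> V 4")
        case True
        then have "adjacent G C (V 4)"
          using C(2) graph_symmetric[OF \<open>x \<rightarrow>\<^bsub>G\<^esub> y\<close>] unfolding adjacent_def by blast
        with C show ?thesis unfolding K_def V3' by blast
      next
        case False
        then obtain D where D: "D \<in> component_verts (G \<restriction> (V 3 - {v}))" "adjacent G D (V 4)" "x \<in> D"
          using x unfolding K_def V3' by blast
        then have "y \<in> D"
          using component_verts_induceD(4)[OF D(1)] \<open>x \<rightarrow>\<^bsub>G\<^esub> y\<close> that unfolding adjacent_def by blast
        with D show ?thesis unfolding K_def V3' by blast
      qed
    qed
    ultimately show "y \<in> K \<or> y = v" using y unfolding K_def by blast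
  qed

  \<comment> \<open>A large part in every feasible tetrapartition\<close>
  have large: "\<exists>X\<in>P. 13 / 24 * ?m \<le> real (card X)" if P: "feasible_tetrapartition G P" for P
  proof (rule ccontr)
    assume "\<not> ?thesis"
    then have lt: "real (card X) < 13 / 24 * ?m" if "X \<in> P" for X
      using that by (simp add: not_le)
    have Ppart: "partition_on (verts G) P" and Pcard: "card P = 4"
      and Pconn: "\<And>X. X \<in> P \<Longrightarrow> Digraph_Component.connected (G \<restriction> X)"
      using P by (auto simp: feasible_tetrapartition_def)
    have finP: "finite P" using Pcard by (intro card_ge_0_finite) simp
    have Psub: "X \<subseteq> verts G" "finite X" "X \<noteq> {}" if "X \<in> P" for X
      using partition_onD1[OF Ppart] partition_onD3[OF Ppart] that
        finite_subset[OF _ finite_verts] by auto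
    have "n = (\<Sum>X\<in>P. card X)"
      unfolding \<open>n = card (verts G)\<close> partition_onD1[OF Ppart]
      using partition_onD2[OF Ppart] Psub(2)
      by (intro card_Union_disjoint) (auto simp: disjoint_def pairwise_def disjnt_def)
    then have sum: "real n = (\<Sum>X\<in>P. real (card X))" by simp
    \<comment> \<open>Otherwise \<open>n\<close> is less than \<open>13/8 + 1/6 = 43/24\<close>
      times \<open>?m\<close>, contradicting \<open>n > 2 * ?m\<close>.\<close>
    have not_small: "card (V 2) < card Y" if "Y \<in> P" for Y
    proof (rule ccontr)
      assume "\<not> card (V 2) < card Y"
      have "(\<Sum>X\<in>P - {Y}. real (card X)) \<le> real (card (P - {Y})) * (13 / 24 * ?m)"
        using lt by (intro sum_bounded_above) (simp add: less_imp_le)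
      also have "card (P - {Y}) = 3" using Pcard that finP by simp
      finally show False
        using sum sum.remove[OF finP that, of "\<lambda>X. real (card X)"] small assms(12)
          \<open>\<not> card (V 2) < card Y\<close> by simp
    qed
    have inside: "Y \<subseteq> S" if "Y \<in> P" "v \<notin> Y" "closed S" "x \<in> Y" "x \<in> S" for Y S x
      using connected_induce_subsetI[OF Pconn[OF that(1)], of S] Psub(1)[OF that(1)] that(2-)
      unfolding closed_def adjacent_def by blast
    \<comment> \<open>Outside \<open>K\<close> and \<open>v\<close> every vertex lies in a closed
      set of size at most \<open>card (V 2)\<close>, too small to contain \<open>Y\<close>.\<close>
    have in_K: "Y \<subseteq> K" if Y: "Y \<in> P" "v \<notin> Y" for Y
    proof -
      obtain x where x: "x \<in> Y" "x \<in> verts G" using Psub[OF Y(1)] by blast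
      have no: "x \<notin> S" if "closed S" "finite S" "card S \<le> card (V 2)" for S
        using inside[OF Y that(1) x(1)] card_mono[OF that(2), of Y] not_small[OF Y(1)] that(3)
        by auto
      have "x \<notin> V 1" "x \<notin> V 2"
        using no closed_V1 closed_V2 fin sorted(1) by auto
      moreover have "x \<in> K" if "x \<in> V 3"
      proof -
        obtain C where C: "C \<in> component_verts (G \<restriction> (V 3 - {v}))" "x \<in> C"
          using cover \<open>x \<in> V 3\<close> x Y(2) by blast
        have "finite C"
          using component_verts_induceD(1)[OF C(1)] fin(3) by (auto intro: finite_subset)
        then have "adjacent G C (V 4)"
          using no[of C] closed_C[OF C(1)] component_le[OF C(1)] sorted(1) C(2) by auto
        with C show ?thesis unfolding K_def V3' by blast
      qed
      ultimately have "x \<in> K" using x(2) unfolding verts K_def by blast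
      with inside[OF Y closed_K x(1)] show ?thesis .
    qed
    obtain X where X: "X \<in> P" "v \<in> X"
      using v partition_onD1[OF Ppart] unfolding verts by blast
    have "v \<notin> Y" if "Y \<in> P" "Y \<noteq> X" for Y
      using partition_onD2[OF Ppart] that X unfolding disjoint_def by blast
    then have "verts G - K \<subseteq> X"
      using in_K partition_onD1[OF Ppart] by blast
    then have "card (verts G - K) \<le> card X"
      using Psub(2)[OF X(1)] by (rule card_mono[rotated])
    moreover have "card (verts G) - card K \<le> card (verts G - K)"
      by (rule diff_card_le_card_Diff) (auto simp: K_def fin intro: finite_subset[OF V3'_sub])
    moreover have "card K \<le> card (V 4) + card V3'"
      unfolding K_def by (rule card_Un_le)
    ultimately have "n \<le> card X + card (V 4) + card V3'"
      using \<open>n = card (verts G)\<close> by linarith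
    \<comment> \<open>Substituting \<open>n\<close> and the bound on \<open>V3'\<close> cancels
      \<open>card (V 2)\<close>; then \<open>V13\<close> leaves \<open>card X\<close> at least
      \<open>1 - 11/24 = 13/24\<close> times \<open>?m\<close>.\<close>
    then show False
      using n V13 assms(23) lt[OF X(1)] by simp
  qed
  obtain P where P: "feasible_tetrapartition G P" "\<And>X. X \<in> P \<Longrightarrow> card X \<le> opt G"
    using ex_tetrapartition_le_opt[OF finite_verts assms(4)] by metis
  obtain X where "X \<in> P" "13 / 24 * ?m \<le> real (card X)"
    using large[OF P(1)] by blast
  moreover from this have "card X \<le> opt G" by (intro P(2))
  ultimately show ?thesis by simp
qed

end
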